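(* Let $M$ be a QTM with time evolution operator $U_M$, and let $|\phi\rangle\in\ell^2_1(\mathfrak{C}^{init}_M)$ be an initial q-configuration, with computation $|\phi_i\rangle=U_M^i|\phi\rangle$ ($i\in\mathbb{N}$). Then the sequence of partial probability distributions $\{P_{|\phi_i\rangle}\}_{i\in\mathbb{N}}$ is monotone, i.e. $P_{|\phi_i\rangle}(n)\le P_{|\phi_j\rangle}(n)$ for all $n\in\mathbb{N}$ and all $i<j$.
   Context: A pre-QTM is a tuple $M=\langle\Sigma,Q,Q_s,Q_t,\delta_0,q_i,q_f\rangle$ with finite tape alphabet $\Sigma\ni 1,\Box$, finite set of states $Q$, source states $Q_s\subseteq Q$ containing the initial state $q_i$, target states $Q_t\subseteq Q$ containing the final state $q_f$, and $\delta_0:(Q\setminus Q_t)\times\Sigma\to\ell^2((Q\setminus Q_s)\times\Sigma\times\{L,R\})$. A configuration is $\langle\alpha,q,\beta,n\rangle\in\Sigma^*\times Q\times\Sigma^*\times\mathbb{N}$ ($\alpha$ the tape to the left of the head, $\beta$ the tape from the head cell on, the head reading the first symbol of $\beta$ or $\Box$ if $\beta$ is empty; $n$ a counter), identified up to adding blanks left of $\alpha$ and right of $\beta$, with $n=0$ whenever $q\notin Q_s\cup Q_t$. $\mathfrak{C}_M$ is the set of configurations, $\mathfrak{C}^{init}_M$ / $\mathfrak{C}^{fin}_M$ those with state $q_i$ / $q_f$. For $C=\langle\alpha,q,u\beta,0\rangle$, let $C_{p,v,R}=\langle\alpha v,p,\beta,0\rangle$ and, writing $\alpha=\alpha'w$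 ($w=\Box$ if $\alpha$ is empty), $C_{p,v,L}=\langle\alpha',p,wv\beta,0\rangle$. The time evolution operator $U_M$ on $\ell^2(\mathfrak{C}_M)$ is the continuous linear extension of: (i) for $C=\langle\alpha,q,u\beta,0\rangle$ with $q\notin Q_t$: $U_M|C\rangle=\sum_{(p,v,d)\in(Q\setminus Q_s)\times\Sigma\times\{L,R\}}\delta_0(q,u)(p,v,d)|C_{p,v,d}\rangle$; (ii) for $q\in Q_s$, $n>0$: $U_M|\langle\alpha,q,\beta,n\rangle\rangle=|\langle\alpha,q,\beta,n-1\rangle\rangle$; (iii) for $q\in Q_t$: $U_M|\langle\alpha,q,\beta,n\rangle\rangle=|\langle\alpha,q,\beta,n+1\rangle\rangle$. $M$ is a QTM if $U_M$ is unitary. $\ell^2_1(B)$ denotes unit vectors of $\ell^2(B)$ (q-configurations). For $C=\langle\alpha,q,\beta,n\rangle$, $\mathrm{val}[C]$ is the number of $1$'s in $\alpha\beta$; for $|\phi\rangle=\sum_Ce_C|C\rangle$, $P_{|\phi\rangle}(n)=\sum_{C\in\mathfrak{C}^{fin}_M,\mathrm{val}[C]=n}|e_C|^2$ (a partial probability distribution, i.e. $P:\mathbb{N}\to[0,1]$ with $\sum_nP(n)\le 1$). *)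

theory Defs
  imports Complex_Main "HOL-Analysis.Infinite_Sum" "HOL-Library.FuncSet"
begin

(* Elements of ell^2(B) are functions on the whole type that vanish outside B, so that
   ell^2(A) is literally contained in ell^2(B) for A a subset of B. *)

definition ell2 :: "'b set \<Rightarrow> ('b \<Rightarrow> complex) set" where
  "ell2 B = {f. (\<forall>x. x \<notin> B \<longrightarrow> f x = 0) \<and> (\<lambda>x. (cmod (f x))\<^sup>2) summable_on B}"

definition ell2_inner :: "'b set \<Rightarrow> ('b \<Rightarrow> complex) \<Rightarrow> ('b \<Rightarrow> complex) \<Rightarrow> complex" where
  "ell2_inner B f g = (\<Sum>\<^sub>\<infinity>x\<in>B. cnj (f x) * g x)"

definition ell2_norm :: "'b set \<Rightarrow> ('b \<Rightarrow> complex) \<Rightarrow> real" where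
  "ell2_norm B f = sqrt (\<Sum>\<^sub>\<infinity>x\<in>B. (cmod (f x))\<^sup>2)"

definition ell2_unit :: "'b set \<Rightarrow> ('b \<Rightarrow> complex) set" where
  "ell2_unit B = {f \<in> ell2 B. ell2_norm B f = 1}"

definition ket :: "'b \<Rightarrow> 'b \<Rightarrow> complex" where
  "ket x = (\<lambda>y. if y = x then 1 else 0)"

definition linear_on_ell2 :: "'b set \<Rightarrow> (('b \<Rightarrow> complex) \<Rightarrow> ('b \<Rightarrow> complex)) \<Rightarrow> bool" where
  "linear_on_ell2 B T \<longleftrightarrow>
     (\<forall>f\<in>ell2 B. \<forall>g\<in>ell2 B. T (\<lambda>x. f x + g x) = (\<lambda>x. T f x + T g x)) \<and>
     (\<forall>a. \<forall>f\<in>ell2 B. T (\<lambda>x. a * f x) = (\<lambda>x. a * T f x))"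

definition continuous_on_ell2 :: "'b set \<Rightarrow> (('b \<Rightarrow> complex) \<Rightarrow> ('b \<Rightarrow> complex)) \<Rightarrow> bool" where
  "continuous_on_ell2 B T \<longleftrightarrow>
     (\<forall>f\<in>ell2 B. \<forall>e>0. \<exists>d>0. \<forall>g\<in>ell2 B.
        ell2_norm B (\<lambda>x. g x - f x) < d \<longrightarrow> ell2_norm B (\<lambda>x. T g x - T f x) < e)"

(* V below is the adjoint of T. *)

definition unitary_on_ell2 :: "'b set \<Rightarrow> (('b \<Rightarrow> complex) \<Rightarrow> ('b \<Rightarrow> complex)) \<Rightarrow> bool" where
  "unitary_on_ell2 B T \<longleftrightarrow>
     T \<in> ell2 B \<rightarrow> ell2 B \<and> linear_on_ell2 B T \<and> continuous_on_ell2 B T \<and>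
     (\<exists>V \<in> ell2 B \<rightarrow> ell2 B.
        (\<forall>f\<in>ell2 B. \<forall>g\<in>ell2 B. ell2_inner B (T f) g = ell2_inner B f (V g)) \<and>
        (\<forall>f\<in>ell2 B. V (T f) = f \<and> T (V f) = f))"

datatype dir = L | R

(* The distinguished symbols 1 and blank of the alphabet are fields of the machine. *)

record ('a, 'q) machine =
  syms :: "'a set"
  one_sym :: 'a
  blank :: 'a
  states :: "'q set"
  sources :: "'q set"
  targets :: "'q set"
  delta :: "'q \<times> 'a \<Rightarrow> 'q \<times> 'a \<times> dir \<Rightarrow> complex"
  init_state :: 'q
  fin_state :: 'q

(* Disjointness of the source and target states is not required here: if they meet, the last
   two clauses of is_time_evolution contradict each other for n > 0, so there is no time
   evolution operator and the machine is not a QTM. *)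

definition pre_qtm :: "('a, 'q) machine \<Rightarrow> bool" where
  "pre_qtm M \<longleftrightarrow>
     finite (syms M) \<and> one_sym M \<in> syms M \<and> blank M \<in> syms M \<and> one_sym M \<noteq> blank M \<and>
     finite (states M) \<and>
     sources M \<subseteq> states M \<and> init_state M \<in> sources M \<and>
     targets M \<subseteq> states M \<and> fin_state M \<in> targets M \<and>
     delta M \<in> (states M - targets M) \<times> syms M
                 \<rightarrow> ell2 ((states M - sources M) \<times> syms M \<times> {L, R})"

type_synonym ('a, 'q) raw_config = "'a list \<times> 'q \<times> 'a list \<times> nat"

definition raw_configs :: "('a, 'q) machine \<Rightarrow> ('a, 'q) raw_config set" where
  "raw_configs M =
     {(\<alpha>, q, \<beta>, n). set \<alpha> \<subseteq> syms M \<and> q \<in> states M \<and> set \<beta> \<subseteq> syms M \<and>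
        (q \<notin> sources M \<union> targets M \<longrightarrow> n = 0)}"

definition config_rel :: "('a, 'q) machine \<Rightarrow> ('a, 'q) raw_config rel" where
  "config_rel M =
     {((\<alpha>, q, \<beta>, n), (\<alpha>', q', \<beta>', n')).
        (\<alpha>, q, \<beta>, n) \<in> raw_configs M \<and> (\<alpha>', q', \<beta>', n') \<in> raw_configs M \<and> q = q' \<and> n = n' \<and>
        (\<exists>i j. replicate i (blank M) @ \<alpha> = replicate j (blank M) @ \<alpha>') \<and>
        (\<exists>i j. \<beta> @ replicate i (blank M) = \<beta>' @ replicate j (blank M))}"

(* Configurations are equivalence classes of tuples. In particular, a tuple with empty right
   part represents the same configuration as the one with right part [blank]. *)

type_synonym ('a, 'q) config = "('a, 'q) raw_config set"

definition configs :: "('a, 'q) machine \<Rightarrow> ('a, 'q) config set" where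
  "configs M = raw_configs M // config_rel M"

definition config_of :: "('a, 'q) machine \<Rightarrow> ('a, 'q) raw_config \<Rightarrow> ('a, 'q) config" where
  "config_of M c = config_rel M `` {c}"

definition configs_in_state :: "('a, 'q) machine \<Rightarrow> 'q \<Rightarrow> ('a, 'q) config set" where
  "configs_in_state M q =
     {config_of M (\<alpha>, q, \<beta>, n) | \<alpha> \<beta> n. (\<alpha>, q, \<beta>, n) \<in> raw_configs M}"

definition init_configs :: "('a, 'q) machine \<Rightarrow> ('a, 'q) config set" where
  "init_configs M = configs_in_state M (init_state M)"

definition fin_configs :: "('a, 'q) machine \<Rightarrow> ('a, 'q) config set" where
  "fin_configs M = configs_in_state M (fin_state M)"

(* The configuration C_{p,v,d} reached from C = (alpha, q, u # beta, 0); it does not depend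
   on q and u. *)

fun successor ::
  "('a, 'q) machine \<Rightarrow> 'a list \<Rightarrow> 'a list \<Rightarrow> 'q \<times> 'a \<times> dir \<Rightarrow> ('a, 'q) config" where
  "successor M \<alpha> \<beta> (p, v, R) = config_of M (\<alpha> @ [v], p, \<beta>, 0)"
| "successor M \<alpha> \<beta> (p, v, L) =
     config_of M (butlast \<alpha>, p, (if \<alpha> = [] then blank M else last \<alpha>) # v # \<beta>, 0)"

(* A continuous linear operator on ell^2(configs M) is determined by its values on the basis
   vectors, so U is unique as an operator on that space; its values on functions outside it
   are irrelevant. *)

definition is_time_evolution ::
  "('a, 'q) machine \<Rightarrow>
   ((('a, 'q) config \<Rightarrow> complex) \<Rightarrow> (('a, 'q) config \<Rightarrow> complex)) \<Rightarrow> bool" where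
  "is_time_evolution M U \<longleftrightarrow>
     U \<in> ell2 (configs M) \<rightarrow> ell2 (configs M) \<and>
     linear_on_ell2 (configs M) U \<and> continuous_on_ell2 (configs M) U \<and>
     (\<forall>\<alpha> q u \<beta>. (\<alpha>, q, u # \<beta>, 0) \<in> raw_configs M \<and> q \<notin> targets M \<longrightarrow>
        U (ket (config_of M (\<alpha>, q, u # \<beta>, 0))) =
          (\<lambda>D. \<Sum>t \<in> (states M - sources M) \<times> syms M \<times> {L, R}.
                 delta M (q, u) t * ket (successor M \<alpha> \<beta> t) D)) \<and>
     (\<forall>\<alpha> q \<beta> n. (\<alpha>, q, \<beta>, n) \<in> raw_configs M \<and> q \<in> sources M \<and> n > 0 \<longrightarrow>
        U (ket (config_of M (\<alpha>, q, \<beta>, n))) = ket (config_of M (\<alpha>, q, \<beta>, n - 1))) \<and>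
     (\<forall>\<alpha> q \<beta> n. (\<alpha>, q, \<beta>, n) \<in> raw_configs M \<and> q \<in> targets M \<longrightarrow>
        U (ket (config_of M (\<alpha>, q, \<beta>, n))) = ket (config_of M (\<alpha>, q, \<beta>, n + 1)))"

definition qtm :: "('a, 'q) machine \<Rightarrow> bool" where
  "qtm M \<longleftrightarrow>
     pre_qtm M \<and> (\<exists>U. is_time_evolution M U \<and> unitary_on_ell2 (configs M) U)"

(* All representatives of a configuration contain the same number of 1's. *)

definition config_val :: "('a, 'q) machine \<Rightarrow> ('a, 'q) config \<Rightarrow> nat" where
  "config_val M C = the_elem ((\<lambda>(\<alpha>, q, \<beta>, n). count_list (\<alpha> @ \<beta>) (one_sym M)) ` C)"

definition output_prob ::
  "('a, 'q) machine \<Rightarrow> (('a, 'q) config \<Rightarrow> complex) \<Rightarrow> nat \<Rightarrow> real" where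
  "output_prob M \<phi> n =
     (\<Sum>\<^sub>\<infinity>C \<in> {C \<in> fin_configs M. config_val M C = n}. (cmod (\<phi> C))\<^sup>2)"

end

theory Submission
  imports Defs
begin

text \<open>
  Raising the counter by one is an injection of the final configurations into themselves that
  preserves the number of 1's. No other basis configuration is sent by \<open>U\<close> to a superposition
  involving a final configuration with positive counter, so the amplitude of a final
  configuration with counter \<open>n\<close> reappears unchanged, one step later, at counter \<open>n + 1\<close>.
  The output probability can therefore only gain the contributions of counter \<open>0\<close>.
\<close>

section \<open>Continuous operators are determined by basis vectors\<close>

lemma ket_eq_iff [simp]: "ket x = ket y \<longleftrightarrow> x = y"
  by (auto simp: ket_def fun_eq_iff split: if_splits)

lemma ell2_mono:
  assumes "f \<in> ell2 A" and "A \<subseteq> B"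
  shows "f \<in> ell2 B"
proof -
  have "(\<lambda>x. (cmod (f x))\<^sup>2) summable_on A \<longleftrightarrow> (\<lambda>x. (cmod (f x))\<^sup>2) summable_on B"
    using assms by (intro summable_on_cong_neutral) (auto simp: ell2_def)
  then show ?thesis
    using assms by (auto simp: ell2_def)
qed

lemma ell2_finite_support:
  assumes "finite F" and "F \<subseteq> B" and "\<And>x. x \<notin> F \<Longrightarrow> f x = 0"
  shows "f \<in> ell2 B"
proof -
  have "f \<in> ell2 F"
    using assms by (simp add: ell2_def)
  then show ?thesis
    using assms(2) by (rule ell2_mono)
qed

lemma ell2_mask:
  assumes "f \<in> ell2 B"
  shows "(\<lambda>x. if x \<in> A then f x else 0) \<in> ell2 B"
  using assms unfolding ell2_def
  by (auto intro!: summable_on_comparison_test[where f = "\<lambda>x. (cmod (f x))\<^sup>2"])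

text \<open>A single term is a subsum of the squared norm; outside \<open>B\<close> the function
  vanishes, so every coordinate is covered.\<close>

lemma cmod_le_ell2_norm:
  assumes "f \<in> ell2 B"
  shows "cmod (f x) \<le> ell2_norm B f"
proof (cases "x \<in> B")
  case True
  have "(\<Sum>\<^sub>\<infinity>y\<in>{x}. (cmod (f y))\<^sup>2) \<le> (\<Sum>\<^sub>\<infinity>y\<in>B. (cmod (f y))\<^sup>2)"
    using assms True by (intro infsum_mono2) (auto simp: ell2_def)
  then show ?thesis
    by (simp add: ell2_norm_def real_le_rsqrt)
next
  case False
  then show ?thesis
    using assms by (simp add: ell2_def ell2_norm_def infsum_nonneg)
qed

text \<open>The finite partial sums converge along \<open>finite_subsets_at_top\<close>, so beyond
  some \<open>F\<close> the squared norm left outside \<open>G\<close> is below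
  \<open>d\<^sup>2\<close>. The bound covers every larger \<open>G\<close>, which leaves room to add
  a chosen index.\<close>

lemma ell2_norm_tail_less:
  assumes f: "f \<in> ell2 B" and "0 < d"
  shows "\<exists>F. finite F \<and> F \<subseteq> B \<and>
    (\<forall>G. finite G \<and> F \<subseteq> G \<and> G \<subseteq> B \<longrightarrow> ell2_norm B (\<lambda>x. if x \<in> - G then f x else 0) < d)"
proof -
  let ?h = "\<lambda>x. (cmod (f x))\<^sup>2"
  have summ: "?h summable_on B"
    using f by (simp add: ell2_def)
  then have "(sum ?h \<longlongrightarrow> infsum ?h B) (finite_subsets_at_top B)"
    by (rule infsum_tendsto)
  then have "eventually (\<lambda>G. dist (sum ?h G) (infsum ?h B) < d\<^sup>2) (finite_subsets_at_top B)"
    by (rule tendstoD) (use \<open>0 < d\<close> in simp)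
  then obtain F where F: "finite F" "F \<subseteq> B"
    and near: "\<And>G. finite G \<Longrightarrow> F \<subseteq> G \<Longrightarrow> G \<subseteq> B \<Longrightarrow> dist (sum ?h G) (infsum ?h B) < d\<^sup>2"
    by (auto simp only: eventually_finite_subsets_at_top)
  have "ell2_norm B (\<lambda>x. if x \<in> - G then f x else 0) < d"
    if G: "finite G" "F \<subseteq> G" "G \<subseteq> B" for G
  proof -
    have "infsum (\<lambda>x. (cmod (if x \<in> - G then f x else 0))\<^sup>2) B = infsum ?h (B - G)"
      by (rule infsum_cong_neutral) auto
    also have "\<dots> = infsum ?h B - sum ?h G"
      using infsum_Diff[OF summ, of G] G by simp
    also have "\<dots> < d\<^sup>2"
      using near[OF G] by (simp add: dist_real_def abs_if split: if_splits)
    finally show ?thesis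
      using \<open>0 < d\<close> by (simp add: ell2_norm_def real_less_lsqrt)
  qed
  with F show ?thesis
    by blast
qed

lemma linear_on_ell2_add:
  "linear_on_ell2 B T \<Longrightarrow> f \<in> ell2 B \<Longrightarrow> g \<in> ell2 B \<Longrightarrow>
     T (\<lambda>x. f x + g x) = (\<lambda>x. T f x + T g x)"
  by (simp add: linear_on_ell2_def)

lemma linear_on_ell2_scale:
  "linear_on_ell2 B T \<Longrightarrow> f \<in> ell2 B \<Longrightarrow> T (\<lambda>x. a * f x) = (\<lambda>x. a * T f x)"
  by (simp add: linear_on_ell2_def)

lemma linear_on_ell2_finite_sum:
  assumes lin: "linear_on_ell2 B T" and "finite F" and "F \<subseteq> B"
  shows "T (\<lambda>y. if y \<in> F then f y else 0) = (\<lambda>y. \<Sum>x\<in>F. f x * T (ket x) y)"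
  using assms(2,3)
proof (induction F)
  case empty
  have "(\<lambda>y. 0) \<in> ell2 B"
    by (rule ell2_finite_support[of "{}"]) auto
  from linear_on_ell2_scale[OF lin this, of 0] show ?case
    by simp
next
  case (insert x F)
  let ?p = "\<lambda>y. if y \<in> F then f y else 0"
  have p: "?p \<in> ell2 B"
    using insert by (intro ell2_finite_support[of F]) auto
  have k: "ket x \<in> ell2 B"
    using insert by (intro ell2_finite_support[of "{x}"]) (auto simp: ket_def)
  have fk: "(\<lambda>y. f x * ket x y) \<in> ell2 B"
    using insert by (intro ell2_finite_support[of "{x}"]) (auto simp: ket_def)
  have "(\<lambda>y. if y \<in> insert x F then f y else 0) = (\<lambda>y. f x * ket x y + ?p y)"
    using insert by (auto simp: ket_def)
  then have "T (\<lambda>y. if y \<in> insert x F then f y else 0) = (\<lambda>y. f x * T (ket x) y + T ?p y)"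
    using linear_on_ell2_add[OF lin fk p] linear_on_ell2_scale[OF lin k, of "f x"] by simp
  then show ?case
    using insert by simp
qed

text \<open>Linearity settles a finite truncation of \<open>f\<close>, and continuity makes the
  image of the remaining tail small in norm, hence small at \<open>y\<close>. Knowing one row of the
  matrix of \<open>T\<close> thus gives that coordinate of \<open>T f\<close> for all
  \<open>f\<close>.\<close>

lemma continuous_linear_ell2_coordinate:
  assumes T: "T \<in> ell2 B \<rightarrow> ell2 B" and lin: "linear_on_ell2 B T"
    and cont: "continuous_on_ell2 B T" and f: "f \<in> ell2 B" and z: "z \<in> B"
    and kets: "\<And>x. x \<in> B \<Longrightarrow> T (ket x) y = (if x = z then 1 else 0)"
  shows "T f y = f z"
proof -
  have "cmod (f z - T f y) < e" if "0 < e" for e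
  proof -
    obtain d where d: "0 < d"
      and near: "\<And>g. g \<in> ell2 B \<Longrightarrow> ell2_norm B (\<lambda>x. g x - f x) < d \<Longrightarrow>
                   ell2_norm B (\<lambda>x. T g x - T f x) < e"
      using cont f \<open>0 < e\<close> unfolding continuous_on_ell2_def by meson
    obtain F where F: "finite F" "F \<subseteq> B"
      and tail: "\<And>G. finite G \<Longrightarrow> F \<subseteq> G \<Longrightarrow> G \<subseteq> B \<Longrightarrow>
                   ell2_norm B (\<lambda>x. if x \<in> - G then f x else 0) < d"
      using ell2_norm_tail_less[OF f d] by auto
    \<comment> \<open>With \<open>z\<close> included, the finite sum over \<open>G\<close> picks up
      exactly the term \<open>f z\<close>.\<close>
    define G where "G = insert z F"
    have G: "finite G" "F \<subseteq> G" "G \<subseteq> B" "z \<in> G"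
      using F z by (auto simp: G_def)
    let ?p = "\<lambda>x. if x \<in> G then f x else 0"
    let ?r = "\<lambda>x. if x \<in> - G then f x else 0"
    have p: "?p \<in> ell2 B" and r: "?r \<in> ell2 B"
      using f by (rule ell2_mask)+
    have "(\<lambda>x. ?p x + ?r x) = f"
      by auto
    then have Tf: "T f = (\<lambda>x. T ?p x + T ?r x)"
      using linear_on_ell2_add[OF lin p r] by simp
    have "ell2_norm B (\<lambda>x. ?p x - f x) = ell2_norm B ?r"
      unfolding ell2_norm_def by (intro arg_cong[where f = sqrt] infsum_cong) simp
    then have "ell2_norm B (\<lambda>x. T ?p x - T f x) < e"
      using near[OF p] tail[OF G(1-3)] by simp
    \<comment> \<open>By \<open>Tf\<close>, the difference of \<open>T ?p\<close> and
      \<open>T f\<close> is \<open>T ?r\<close> up to sign.\<close>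
    then have "ell2_norm B (T ?r) < e"
      by (simp add: Tf ell2_norm_def)
    moreover have "cmod (T ?r y) \<le> ell2_norm B (T ?r)"
      using T r by (intro cmod_le_ell2_norm) auto
    moreover have "T ?p y = f z"
    proof -
      have "T ?p y = (\<Sum>x\<in>G. f x * T (ket x) y)"
        using linear_on_ell2_finite_sum[OF lin G(1,3)] by simp
      also have "\<dots> = (\<Sum>x\<in>G. if x = z then f x else 0)"
        using G(3) by (intro sum.cong) (auto simp: kets)
      also have "\<dots> = f z"
        using G by simp
      finally show ?thesis .
    qed
    ultimately show ?thesis
      by (simp add: Tf)
  qed
  then show ?thesis
    by (metis less_irrefl zero_less_norm_iff right_minus_eq)
qed

section \<open>Configurations and their counters\<close>

text \<open>Padding by blanks touches neither state nor counter. This is the test used below to tell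
  two configurations apart.\<close>

lemma config_of_memD:
  assumes "(\<alpha>', q', \<beta>', n') \<in> config_of M (\<alpha>, q, \<beta>, n)"
  shows "q' = q" and "n' = n"
  using assms by (simp_all add: config_of_def config_rel_def)

lemma config_of_self: "c \<in> raw_configs M \<Longrightarrow> c \<in> config_of M c"
  by (cases c) (auto simp: config_of_def config_rel_def)

lemma configs_cases:
  assumes "C \<in> configs M"
  obtains \<alpha> q \<beta> n where "(\<alpha>, q, \<beta>, n) \<in> raw_configs M" "C = config_of M (\<alpha>, q, \<beta>, n)"
  using assms by (auto simp: configs_def config_of_def elim!: quotientE)

lemma configs_in_state_subset: "configs_in_state M q \<subseteq> configs M"
  by (auto simp: configs_in_state_def configs_def config_of_def intro: quotientI)

text \<open>The extra blank is absorbed by the right padding. The transition clause of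
  \<open>is_time_evolution\<close> speaks only of right parts \<open>u # \<beta>\<close>, so an
  empty one must first be rewritten this way.\<close>

lemma config_of_empty_right:
  assumes "blank M \<in> syms M"
  shows "config_of M (\<alpha>, q, [], n) = config_of M (\<alpha>, q, [blank M], n)"
proof -
  have "(\<exists>i j. replicate i (blank M) = \<beta> @ replicate j (blank M)) \<longleftrightarrow>
        (\<exists>i j. blank M # replicate i (blank M) = \<beta> @ replicate j (blank M))" for \<beta>
  proof
    assume "\<exists>i j. replicate i (blank M) = \<beta> @ replicate j (blank M)"
    then obtain i j where "replicate i (blank M) = \<beta> @ replicate j (blank M)"
      by blast
    \<comment> \<open>Append a blank to both sides; on the left, a block of blanks lets it move to
      the front.\<close>
    then have "blank M # replicate i (blank M) = \<beta> @ replicate (Suc j) (blank M)"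
      by (metis append.assoc replicate_append_same replicate_Suc)
    then show "\<exists>i j. blank M # replicate i (blank M) = \<beta> @ replicate j (blank M)"
      by blast
  next
    assume "\<exists>i j. blank M # replicate i (blank M) = \<beta> @ replicate j (blank M)"
    then show "\<exists>i j. replicate i (blank M) = \<beta> @ replicate j (blank M)"
      by (metis replicate_Suc)
  qed
  then show ?thesis
    using assms by (auto simp: config_of_def config_rel_def raw_configs_def)
qed

definition incr_raw :: "('a, 'q) raw_config \<Rightarrow> ('a, 'q) raw_config" where
  "incr_raw = (\<lambda>(\<alpha>, q, \<beta>, n). (\<alpha>, q, \<beta>, Suc n))"

text \<open>Taking the image of the whole class avoids choosing a representative and makes
  injectivity immediate.\<close>

definition incr :: "('a, 'q) config \<Rightarrow> ('a, 'q) config" where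
  "incr C = incr_raw ` C"

lemma inj_incr_raw: "inj incr_raw"
  by (auto simp: incr_raw_def inj_on_def)

lemma inj_incr: "inj incr"
  by (intro injI) (simp add: incr_def inj_image_eq_iff[OF inj_incr_raw])

text \<open>A target state admits every counter, so raising it neither leaves
  \<open>raw_configs\<close> nor misses a representative.\<close>

lemma incr_config_of:
  assumes "q \<in> targets M"
  shows "incr (config_of M (\<alpha>, q, \<beta>, n)) = config_of M (\<alpha>, q, \<beta>, Suc n)"
  using assms
  by (force simp: incr_def incr_raw_def config_of_def config_rel_def raw_configs_def image_iff)

text \<open>Both sides apply \<open>the_elem\<close> to the same set of counts, so \<open>C\<close>
  may be any set of tuples.\<close>

lemma config_val_incr [simp]: "config_val M (incr C) = config_val M C"
proof -
  have "(\<lambda>(\<alpha>, q, \<beta>, n). count_list (\<alpha> @ \<beta>) (one_sym M)) ` incr_raw ` C =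
        (\<lambda>(\<alpha>, q, \<beta>, n). count_list (\<alpha> @ \<beta>) (one_sym M)) ` C"
    by (simp add: image_image incr_raw_def case_prod_unfold)
  then show ?thesis
    by (simp only: config_val_def incr_def)
qed

lemma incr_fin_configs:
  assumes "fin_state M \<in> targets M" and "C \<in> fin_configs M"
  shows "incr C \<in> fin_configs M"
proof -
  obtain \<alpha> \<beta> n where raw: "(\<alpha>, fin_state M, \<beta>, n) \<in> raw_configs M"
    and C: "C = config_of M (\<alpha>, fin_state M, \<beta>, n)"
    using assms(2) by (auto simp: fin_configs_def configs_in_state_def)
  have "(\<alpha>, fin_state M, \<beta>, Suc n) \<in> raw_configs M"
    using raw assms(1) by (auto simp: raw_configs_def)
  then show ?thesis
    using C assms(1) by (auto simp: incr_config_of fin_configs_def configs_in_state_def)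
qed

text \<open>The tuple shows a final state and a positive counter at once: the former rules out
  images under the source clause, the latter images under the transition clause.\<close>

lemma incr_fin_config_nonempty:
  assumes "C \<in> fin_configs M"
  obtains \<alpha> \<beta> n where "(\<alpha>, fin_state M, \<beta>, Suc n) \<in> incr C"
proof -
  obtain \<alpha> \<beta> n where "(\<alpha>, fin_state M, \<beta>, n) \<in> C"
    using assms config_of_self by (fastforce simp: fin_configs_def configs_in_state_def)
  then have "(\<alpha>, fin_state M, \<beta>, Suc n) \<in> incr C"
    by (force simp: incr_def incr_raw_def)
  then show thesis ..
qed

lemma successor_counter:
  "(\<alpha>', q', \<beta>', n') \<in> successor M \<alpha> \<beta> t \<Longrightarrow> n' = 0"
  by (cases "(M, \<alpha>, \<beta>, t)" rule: successor.cases) (auto dest: config_of_memD)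

section \<open>One step of the time evolution\<close>

lemma time_evolution_source:
  assumes "is_time_evolution M U" and "(\<alpha>, q, \<beta>, Suc n) \<in> raw_configs M" and "q \<in> sources M"
  shows "U (ket (config_of M (\<alpha>, q, \<beta>, Suc n))) = ket (config_of M (\<alpha>, q, \<beta>, n))"
  using assms by (simp add: is_time_evolution_def)

lemma time_evolution_target:
  assumes "is_time_evolution M U" and "(\<alpha>, q, \<beta>, n) \<in> raw_configs M" and "q \<in> targets M"
  shows "U (ket (config_of M (\<alpha>, q, \<beta>, n))) = ket (config_of M (\<alpha>, q, \<beta>, Suc n))"
  using assms by (simp add: is_time_evolution_def)

text \<open>Otherwise the empty tape with counter 1 would be sent to counter 0 by the source clause
  and to counter 2 by the target clause.\<close>

lemma time_evolution_fin_not_source: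
  assumes M: "pre_qtm M" and U: "is_time_evolution M U"
  shows "fin_state M \<notin> sources M"
proof
  assume src: "fin_state M \<in> sources M"
  have tgt: "fin_state M \<in> targets M" and st: "fin_state M \<in> states M"
    using M by (auto simp: pre_qtm_def)
  have raw: "([], fin_state M, [], k) \<in> raw_configs M" for k
    using tgt st by (auto simp: raw_configs_def)
  have "config_of M ([], fin_state M, [], 0) = config_of M ([], fin_state M, [], Suc (Suc 0))"
    using time_evolution_source[OF U raw src, of 0] time_evolution_target[OF U raw tgt, of "Suc 0"]
    by simp
  then show False
    using config_of_self[OF raw, of 0] by (auto dest: config_of_memD)
qed

text \<open>This is the row of \<open>U\<close> at \<open>incr C\<close>, found by cases on the
  clause that applies to \<open>D\<close>: target, source with positive counter, or
  transition.\<close>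

lemma time_evolution_ket_incr:
  assumes M: "pre_qtm M" and U: "is_time_evolution M U"
    and C: "C \<in> fin_configs M" and D: "D \<in> configs M"
  shows "U (ket D) (incr C) = (if D = C then 1 else 0)"
proof -
  obtain \<alpha> q \<beta> n where raw: "(\<alpha>, q, \<beta>, n) \<in> raw_configs M"
    and D_eq: "D = config_of M (\<alpha>, q, \<beta>, n)"
    using D by (rule configs_cases)
  obtain a b m where mem: "(a, fin_state M, b, Suc m) \<in> incr C"
    using C by (rule incr_fin_config_nonempty)
  have tgt: "fin_state M \<in> targets M" and blank: "blank M \<in> syms M"
    using M by (auto simp: pre_qtm_def)
  obtain a' b' k where C_eq: "C = config_of M (a', fin_state M, b', k)"
    and raw_C: "(a', fin_state M, b', k) \<in> raw_configs M"
    using C by (auto simp: fin_configs_def configs_in_state_def)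
  show ?thesis
  proof (cases "q \<in> targets M")
    case True
    \<comment> \<open>On every target state \<open>U\<close> acts as \<open>incr\<close>, so
      injectivity of \<open>incr\<close> decides the case.\<close>
    then have "U (ket D) = ket (incr D)"
      using time_evolution_target[OF U raw] by (simp add: D_eq incr_config_of)
    then show ?thesis
      using inj_incr by (auto simp: ket_def dest: injD)
  next
    case False
    have "D \<noteq> C"
      using False tgt config_of_self[OF raw_C] by (auto simp: D_eq C_eq dest: config_of_memD)
    moreover have "U (ket D) (incr C) = 0"
    proof (cases "n = 0")
      case False
      \<comment> \<open>Only source and target states carry a positive counter.\<close>
      then have src: "q \<in> sources M"
        using raw \<open>q \<notin> targets M\<close> by (auto simp: raw_configs_def)
      have "U (ket D) = ket (config_of M (\<alpha>, q, \<beta>, n - 1))"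
        using time_evolution_source[OF U _ src, of \<alpha> \<beta> "n - 1"] raw False by (simp add: D_eq)
      moreover have "incr C \<noteq> config_of M (\<alpha>, q, \<beta>, n - 1)"
        using mem src time_evolution_fin_not_source[OF M U] by (auto dest: config_of_memD)
      ultimately show ?thesis
        by (simp add: ket_def)
    next
      case True
      obtain u \<beta>' where raw': "(\<alpha>, q, u # \<beta>', 0) \<in> raw_configs M"
        and D': "D = config_of M (\<alpha>, q, u # \<beta>', 0)"
      proof (cases \<beta>)
        case Nil
        then show thesis
          using that[of "blank M" "[]"] raw D_eq True blank config_of_empty_right[OF blank]
          by (auto simp: raw_configs_def)
      next
        case (Cons u \<beta>')
        then show thesis
          using that raw D_eq True by simp
      qed
      have "U (ket D) = (\<lambda>E. \<Sum>t \<in> (states M - sources M) \<times> syms M \<times> {L, R}.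
                               delta M (q, u) t * ket (successor M \<alpha> \<beta>' t) E)"
        using U raw' False unfolding is_time_evolution_def D' by blast
      moreover have "incr C \<noteq> successor M \<alpha> \<beta>' t" for t
        using mem by (auto dest: successor_counter)
      ultimately show ?thesis
        by (simp add: ket_def)
    qed
    ultimately show ?thesis
      by simp
  qed
qed

lemma output_prob_step:
  assumes M: "pre_qtm M" and U: "is_time_evolution M U" and \<psi>: "\<psi> \<in> ell2 (configs M)"
  shows "output_prob M \<psi> n \<le> output_prob M (U \<psi>) n"
proof -
  let ?S = "{C \<in> fin_configs M. config_val M C = n}"
  have fin: "fin_configs M \<subseteq> configs M"
    by (simp add: fin_configs_def configs_in_state_subset)
  have U\<psi>: "U \<psi> \<in> ell2 (configs M)"
    using U \<psi> by (auto simp: is_time_evolution_def)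
  have summ: "(\<lambda>C. (cmod (U \<psi> C))\<^sup>2) summable_on A" if "A \<subseteq> configs M" for A
    using U\<psi> that by (auto simp: ell2_def intro: summable_on_subset_banach)
  \<comment> \<open>The coordinate lemma is applied with \<open>z = C\<close> and
    \<open>y = incr C\<close>.\<close>
  have step: "U \<psi> (incr C) = \<psi> C" if "C \<in> fin_configs M" for C
    using U \<psi> that fin time_evolution_ket_incr[OF M U that]
    by (intro continuous_linear_ell2_coordinate[of U "configs M"])
       (auto simp: is_time_evolution_def)
  have sub: "incr ` ?S \<subseteq> ?S"
    using M by (auto simp: pre_qtm_def intro: incr_fin_configs)
  have "output_prob M \<psi> n = (\<Sum>\<^sub>\<infinity>C\<in>?S. (cmod (U \<psi> (incr C)))\<^sup>2)"
    unfolding output_prob_def by (intro infsum_cong) (simp add: step)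
  also have "\<dots> = (\<Sum>\<^sub>\<infinity>C\<in>incr ` ?S. (cmod (U \<psi> C))\<^sup>2)"
    by (subst infsum_reindex) (auto simp: o_def intro: inj_on_subset[OF inj_incr])
  \<comment> \<open>Members of \<open>?S\<close> outside the image of \<open>incr\<close> only add
    nonnegative terms.\<close>
  also have "\<dots> \<le> output_prob M (U \<psi>) n"
    unfolding output_prob_def using sub fin by (intro infsum_mono2 summ) auto
  finally show ?thesis .
qed

theorem theorem3p3:
  fixes M :: "('a, 'q) machine"
    and U :: "(('a, 'q) config \<Rightarrow> complex) \<Rightarrow> (('a, 'q) config \<Rightarrow> complex)"
    and \<phi> :: "('a, 'q) config \<Rightarrow> complex"
    and n i j :: nat
  assumes "qtm M"
    and "is_time_evolution M U"
    and "\<phi> \<in> ell2_unit (init_configs M)"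
    and "i < j"
  shows "output_prob M ((U ^^ i) \<phi>) n \<le> output_prob M ((U ^^ j) \<phi>) n"
proof -
  have M: "pre_qtm M"
    using assms(1) by (simp add: qtm_def)
  have "\<phi> \<in> ell2 (init_configs M)"
    using assms(3) by (simp add: ell2_unit_def)
  then have \<phi>: "\<phi> \<in> ell2 (configs M)"
    by (rule ell2_mono) (simp add: init_configs_def configs_in_state_subset)
  \<comment> \<open>Each iterate stays in the space, so the one-step inequality can be chained from
    \<open>i\<close> to \<open>j\<close>.\<close>
  have iterate: "(U ^^ k) \<phi> \<in> ell2 (configs M)" for k
    using assms(2) \<phi> by (induction k) (auto simp: is_time_evolution_def)
  have "output_prob M ((U ^^ k) \<phi>) n \<le> output_prob M ((U ^^ Suc k) \<phi>) n" for k
    using output_prob_step[OF M assms(2) iterate] by simp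
  then show ?thesis
    using lift_Suc_mono_le[where f = "\<lambda>k. output_prob M ((U ^^ k) \<phi>) n"] assms(4)
    by (meson less_imp_le)
qed

end
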